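(* For every self-similar group $(G,X)$, the commutator subgroup $\mathcal{V}_G'=[\mathcal{V}_G,\mathcal{V}_G]$ of $\mathcal{V}_G$ is simple.
   Context: Let $X$ be a finite set with $|X|\ge2$, $X^*$ the rooted tree of finite words (each $v$ joined to $vx$), $X^\omega$ the space of right-infinite sequences with the product topology. A complete antichain is a finite set $A\subset X^*$ of words, none a prefix of another, with $X^\omega=\bigsqcup_{v\in A}vX^\omega$. A self-similar group $(G,X)$ is a group $G$ acting faithfully by automorphisms of $X^*$ such that for every $g\in G$, $x\in X$ there exist $h\in G$, $y\in X$ with $g(xw)=yh(w)$ for all $w$. $\mathcal{V}_G$ is the group of all homeomorphisms $g$ of $X^\omega$ for which there exist complete antichains $A_1,A_2$, a bijection $\alpha:A_1\to A_2$ and $g_v\in G$ ($v\in A_1$) with $g(vw)=\alpha(v)g_v(w)$ for all $v\in A_1$, $w\in X^\omega$. *)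

theory Defs
  imports "HOL-Analysis.Analysis" "HOL-Algebra.Algebra"
begin

text \<open>Finite words over the alphabet 'x are lists; right-infinite sequences are
functions nat => 'x. In X* each word v is joined to each word v@[x].\<close>

definition tree_adj :: "'x list \<Rightarrow> 'x list \<Rightarrow> bool" where
  "tree_adj u v \<longleftrightarrow> (\<exists>x. v = u @ [x]) \<or> (\<exists>x. u = v @ [x])"

definition tree_aut :: "('x list \<Rightarrow> 'x list) \<Rightarrow> bool" where
  "tree_aut g \<longleftrightarrow> bij g \<and> g [] = [] \<and> (\<forall>u v. tree_adj u v \<longleftrightarrow> tree_adj (g u) (g v))"

definition cantor_top :: "(nat \<Rightarrow> 'x) topology" where
  "cantor_top = product_topology (\<lambda>_. discrete_topology UNIV) UNIV"

definition conc :: "'x list \<Rightarrow> (nat \<Rightarrow> 'x) \<Rightarrow> (nat \<Rightarrow> 'x)" where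
  "conc v w = (\<lambda>n. if n < length v then v ! n else w (n - length v))"

definition cyl :: "'x list \<Rightarrow> (nat \<Rightarrow> 'x) set" where
  "cyl v = {conc v w | w. True}"

text \<open>The induced action of a tree automorphism on X^omega:
the n-th letter of g(w) is the n-th letter of g applied to the prefix of length n+1.\<close>
definition bact :: "('x list \<Rightarrow> 'x list) \<Rightarrow> (nat \<Rightarrow> 'x) \<Rightarrow> (nat \<Rightarrow> 'x)" where
  "bact g w = (\<lambda>n. g (map w [0..<Suc n]) ! n)"

text \<open>Self-similar group: a group G of automorphisms of X* (faithfulness is automatic,
G being a set of automorphisms) with the self-similarity property.\<close>
definition self_similar :: "('x list \<Rightarrow> 'x list) set \<Rightarrow> bool" where
  "self_similar G \<longleftrightarrow>
     (\<forall>g\<in>G. tree_aut g) \<and> id \<in> G \<and> (\<forall>g\<in>G. \<forall>h\<in>G. g \<circ> h \<in> G) \<and> (\<forall>g\<in>G. inv_into UNIV g \<in> G) \<and>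
     (\<forall>g\<in>G. \<forall>x. \<exists>h\<in>G. \<exists>y. \<forall>w. g (x # w) = y # h w)"

definition complete_antichain :: "'x list set \<Rightarrow> bool" where
  "complete_antichain A \<longleftrightarrow> finite A \<and>
     (\<forall>u\<in>A. \<forall>v\<in>A. (\<exists>t. v = u @ t) \<longrightarrow> u = v) \<and>
     (\<Union>v\<in>A. cyl v) = UNIV \<and> disjoint_family_on cyl A"

definition VG :: "('x list \<Rightarrow> 'x list) set \<Rightarrow> ((nat \<Rightarrow> 'x) \<Rightarrow> (nat \<Rightarrow> 'x)) set" where
  "VG G = {g. homeomorphic_map cantor_top cantor_top g \<and>
     (\<exists>A1 A2 \<alpha> gv. complete_antichain A1 \<and> complete_antichain A2 \<and> bij_betw \<alpha> A1 A2 \<and>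
        (\<forall>v\<in>A1. gv v \<in> G \<and> (\<forall>w. g (conc v w) = conc (\<alpha> v) (bact (gv v) w))))}"

definition VG_group :: "('x list \<Rightarrow> 'x list) set \<Rightarrow> ((nat \<Rightarrow> 'x) \<Rightarrow> (nat \<Rightarrow> 'x)) monoid" where
  "VG_group G = \<lparr>carrier = VG G, monoid.mult = (\<circ>), one = id\<rparr>"

text \<open>Simple group (possibly infinite): nontrivial group whose only normal subgroups
are the trivial one and the whole group. (The library locale simple_group uses
order G > 1, which fails for infinite groups.)\<close>
definition simple_grp :: "('a, 'b) monoid_scheme \<Rightarrow> bool" where
  "simple_grp H \<longleftrightarrow> group H \<and> carrier H \<noteq> {\<one>\<^bsub>H\<^esub>} \<and>
     (\<forall>N. normal N H \<longrightarrow> N = {\<one>\<^bsub>H\<^esub>} \<or> N = carrier H)"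

end

theory Submission
  imports Defs
begin

text \<open>
  The group \<open>V\<close> consists of the bijections of \<open>X\<^sup>\<omega>\<close> that are locally of the form
  \<open>vw \<mapsto> u g(w)\<close> with \<open>g\<close> in \<open>G\<close>. Let \<open>N\<close> be a nontrivial normal subgroup of \<open>D = V'\<close>.
  An element of \<open>N\<close> moves some cylinder off itself, and a double commutator puts \<open>[f, g]\<close> into
  \<open>N\<close> for all \<open>f\<close>, \<open>g\<close> in \<open>V\<close> supported in a smaller cylinder \<open>W\<close>. Every element of \<open>V\<close> agrees on
  \<open>W\<close> with an element of \<open>D\<close>, so these commutators even lie in the largest subgroup \<open>M\<close> of \<open>N\<close>
  that is normal in \<open>V\<close>. As the complement of any nonempty cylinder can be moved into \<open>W\<close>, two
  elements fixing a common cylinder commute modulo \<open>M\<close>. Elements fixing different cylinders can be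
  conjugated, modulo \<open>M\<close>, to elements fixing a common one, and every element of \<open>V\<close> is a product of
  two elements each fixing a cylinder. Hence \<open>V/M\<close> is abelian and \<open>D \<subseteq> M \<subseteq> N\<close>.
\<close>

unbundle no m_inv_syntax

section \<open>Words and sequences\<close>

definition pre :: "(nat \<Rightarrow> 'x) \<Rightarrow> nat \<Rightarrow> 'x list" where
  "pre p n = map p [0..<n]"

definition shift :: "nat \<Rightarrow> (nat \<Rightarrow> 'x) \<Rightarrow> (nat \<Rightarrow> 'x)" where
  "shift n p = (\<lambda>i. p (n + i))"

lemma length_pre [simp]: "length (pre p n) = n"
  by (simp add: pre_def)

lemma nth_pre [simp]: "i < n \<Longrightarrow> pre p n ! i = p i"
  by (simp add: pre_def)

lemma pre_0 [simp]: "pre p 0 = []"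
  by (simp add: pre_def)

lemma pre_Suc: "pre p (Suc n) = pre p n @ [p n]"
  by (simp add: pre_def)

lemma pre_add: "pre p (n + m) = pre p n @ pre (shift n p) m"
  by (intro nth_equalityI) (auto simp: nth_append shift_def)

lemma take_pre: "m \<le> n \<Longrightarrow> take m (pre p n) = pre p m"
  by (intro nth_equalityI) auto

lemma seq_eqI: "(\<And>n. pre p n = pre q n) \<Longrightarrow> p = q"
  by (rule ext) (metis lessI nth_pre)

lemma pre_eq_mono: "pre p n = pre q n \<Longrightarrow> m \<le> n \<Longrightarrow> pre p m = pre q m"
  by (metis take_pre)

lemma conc_Nil [simp]: "conc [] w = w"
  by (simp add: conc_def)

lemma conc_append: "conc (u @ v) w = conc u (conc v w)"
  by (rule ext) (auto simp: conc_def nth_append)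

lemma conc_nth: "i < length v \<Longrightarrow> conc v w i = v ! i"
  by (simp add: conc_def)

lemma conc_pre_shift [simp]: "conc (pre p n) (shift n p) = p"
  by (auto simp: conc_def shift_def)

lemma pre_conc [simp]: "pre (conc v w) (length v) = v"
  by (intro nth_equalityI) (auto simp: conc_def)

lemma shift_conc [simp]: "shift (length v) (conc v w) = w"
  by (auto simp: conc_def shift_def)

lemma pre_conc_pre [simp]: "pre (conc (pre p n) w) n = pre p n"
  using pre_conc[of "pre p n" w] by simp

lemma mem_cyl: "p \<in> cyl v \<longleftrightarrow> pre p (length v) = v"
  unfolding cyl_def by (auto) (metis conc_pre_shift)

lemma conc_mem_cyl [simp]: "conc v w \<in> cyl v"
  by (simp add: mem_cyl)

lemma conc_shift_cyl: "p \<in> cyl v \<Longrightarrow> conc v (shift (length v) p) = p"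
  by (metis mem_cyl conc_pre_shift)

lemma cyl_append_subset: "p \<in> cyl (v @ t) \<Longrightarrow> p \<in> cyl v"
  by (metis conc_append conc_mem_cyl conc_shift_cyl)

lemma conc_mem_cyl_append [simp]: "conc v w \<in> cyl (v @ t) \<longleftrightarrow> w \<in> cyl t"
  by (metis conc_append conc_mem_cyl conc_shift_cyl shift_conc)

text \<open>A common point begins with both words, so the shorter one begins the longer one.\<close>

lemma cyl_Int_imp_prefix:
  assumes "cyl u \<inter> cyl v \<noteq> {}" and "length u \<le> length v"
  shows "\<exists>t. v = u @ t"
proof -
  obtain p where "pre p (length u) = u" "pre p (length v) = v"
    using assms(1) by (auto simp: mem_cyl)
  then show ?thesis
    using assms(2) pre_add[of p "length u" "length v - length u"] by auto
qed

lemma cyl_disjoint_nth: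
  assumes "i < length u" "i < length v" "u ! i \<noteq> v ! i"
  shows "cyl u \<inter> cyl v = {}"
  using assms by (auto simp: mem_cyl) (metis nth_pre)

lemma cyl_append_disjoint:
  assumes "cyl s \<inter> cyl t = {}"
  shows "cyl (u @ s) \<inter> cyl (u @ t) = {}"
proof (rule ccontr)
  assume "\<not> ?thesis"
  then obtain p where p: "p \<in> cyl (u @ s)" "p \<in> cyl (u @ t)" by auto
  then have "p = conc u (shift (length u) p)"
    by (metis cyl_append_subset conc_shift_cyl)
  then have "shift (length u) p \<in> cyl s \<inter> cyl t"
    using p by (metis IntI conc_mem_cyl_append)
  then show False using assms by blast
qed

lemma cyl_Cons_iff: "p \<in> cyl (x # t) \<longleftrightarrow> p 0 = x \<and> shift 1 p \<in> cyl t"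
  using pre_add[of p 1 "length t"] by (simp add: mem_cyl pre_Suc)

lemma cyl_Nil [simp]: "p \<in> cyl []"
  by (simp add: mem_cyl)

text \<open>The prefix condition comes from disjointness: if \<open>u\<close> begins
  \<open>v\<close>, every point of \<open>cyl v\<close> lies in both cylinders.\<close>

lemma complete_antichainI:
  assumes "finite A" "(\<Union>v\<in>A. cyl v) = UNIV" "disjoint_family_on cyl A"
  shows "complete_antichain A"
  unfolding complete_antichain_def
proof (intro conjI ballI impI)
  fix u v :: "'a list" assume uv: "u \<in> A" "v \<in> A" "\<exists>t. v = u @ t"
  have "conc v (\<lambda>_. undefined) \<in> cyl v \<inter> cyl u"
    using uv(3) by (auto intro: cyl_append_subset conc_mem_cyl)
  then show "u = v" using assms(3) uv(1,2) unfolding disjoint_family_on_def by blast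
qed (use assms in auto)

text \<open>Compactness of the sequence space, proved as Koenig's lemma: since the alphabet is
  finite, a word with no uniform bound below it has a one-letter extension of the same kind, and the
  infinite path built from these contradicts \<open>loc\<close>.\<close>

lemma uniform_length:
  fixes P :: "'x::finite list \<Rightarrow> bool"
  assumes ext: "\<And>v t. P v \<Longrightarrow> P (v @ t)" and loc: "\<And>p. \<exists>n. P (pre p n)"
  shows "\<exists>n. \<forall>v. length v = n \<longrightarrow> P v"
proof -
  define good where "good v \<longleftrightarrow> (\<exists>n. \<forall>t. n \<le> length t \<longrightarrow> P (v @ t))" for v
  have step: "\<exists>x. \<not> good (v @ [x])" if bad: "\<not> good v" for v
  proof (rule ccontr)
    assume "\<not> ?thesis"
    then have "\<forall>x. \<exists>n. \<forall>t. n \<le> length t \<longrightarrow> P ((v @ [x]) @ t)"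
      by (auto simp: good_def)
    then obtain n where n: "\<And>x t. n x \<le> length t \<Longrightarrow> P ((v @ [x]) @ t)"
      by metis
    \<comment> \<open>The largest of the finitely many bounds serves all letters; \<open>Suc\<close>
      accounts for the letter itself.\<close>
    have "P (v @ t)" if t: "Suc (Max (range n)) \<le> length t" for t
    proof (cases t)
      case Nil
      then show ?thesis using t by simp
    next
      case (Cons x s)
      have "n x \<le> Max (range n)" by simp
      then have "n x \<le> length s" using t Cons by simp
      then show ?thesis using n[of x s] Cons by simp
    qed
    then have "good v" unfolding good_def by blast
    then show False using bad by simp
  qed
  have "good []"
  proof (rule ccontr)
    assume bad: "\<not> good []"
    \<comment> \<open>Bad words are continued by bad words; \<open>f n\<close> is the prefix of
      length \<open>n\<close> of the resulting path.\<close>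
    define nx where "nx v = (SOME x. \<not> good (v @ [x]))" for v
    define f where "f = rec_nat [] (\<lambda>_ v. v @ [nx v])"
    have f0: "f 0 = []" and fS: "\<And>n. f (Suc n) = f n @ [nx (f n)]"
      by (auto simp: f_def)
    have badf: "\<not> good (f n)" for n
    proof (induction n)
      case (Suc n)
      then show ?case unfolding fS nx_def by (rule someI_ex[OF step])
    qed (simp add: f0 bad)
    have "pre (\<lambda>n. nx (f n)) n = f n" for n
      by (induction n) (auto simp: f0 fS pre_Suc)
    then obtain n where "P (f n)" using loc[of "\<lambda>n. nx (f n)"] by auto
    then have "good (f n)" unfolding good_def using ext by blast
    then show False using badf by blast
  qed
  then obtain n where "\<forall>t. n \<le> length t \<longrightarrow> P t"
    unfolding good_def by auto
  then show ?thesis by (intro exI[of _ n]) simp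
qed

lemma topspace_cantor_top [simp]: "topspace cantor_top = UNIV"
  by (simp add: cantor_top_def)

lemma openin_cantor_coordinate: "openin cantor_top {p. p i = (a::'x)}"
proof -
  have "continuous_map cantor_top (discrete_topology UNIV) (\<lambda>p :: nat \<Rightarrow> 'x. p i)"
    unfolding cantor_top_def by (rule continuous_map_product_projection) simp
  from openin_continuous_map_preimage[OF this, of "{a}"] show ?thesis
    by simp
qed

lemma openin_cyl: "openin cantor_top (cyl v)"
proof -
  have "cyl v = topspace cantor_top \<inter> (\<Inter>i\<in>{..<length v}. {p. p i = v ! i})"
    by (auto simp: mem_cyl intro!: nth_equalityI) (metis nth_pre)
  also have "openin cantor_top \<dots>"
  proof (cases "length v = 0")
    case True
    then show ?thesis using openin_topspace[of "cantor_top :: (nat \<Rightarrow> 'a) topology"] by simp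
  next
    case False
    then have "openin cantor_top (\<Inter>i\<in>{..<length v}. {p. p i = v ! i})"
      by (intro openin_INT2) (auto simp: openin_cantor_coordinate)
    then show ?thesis by simp
  qed
  finally show ?thesis .
qed

section \<open>Locally defined elements\<close>

locale self_similar_group =
  fixes G :: "('x::finite list \<Rightarrow> 'x list) set"
  assumes card: "CARD('x) \<ge> 2" and ss: "self_similar G"
begin

section \<open>The action of \<open>G\<close> on words and on sequences\<close>

lemma id_in_G [simp]: "id \<in> G"
  and comp_in_G: "g \<in> G \<Longrightarrow> h \<in> G \<Longrightarrow> g \<circ> h \<in> G"
  and inv_in_G: "g \<in> G \<Longrightarrow> inv g \<in> G"
  and bij_G: "g \<in> G \<Longrightarrow> bij g"
  and G_Nil: "g \<in> G \<Longrightarrow> g [] = []"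
  and G_Cons: "g \<in> G \<Longrightarrow> \<exists>h\<in>G. \<exists>y. \<forall>w. g (x # w) = y # h w"
  using ss by (auto simp: self_similar_def tree_aut_def)

lemma length_G: "g \<in> G \<Longrightarrow> length (g w) = length w"
proof (induction w arbitrary: g)
  case Nil
  then show ?case by (simp add: G_Nil)
next
  case (Cons x w)
  then show ?case using G_Cons[of g x] by fastforce
qed

text \<open>Iterating \<open>G_Cons\<close> along \<open>t\<close> yields the section of
  \<open>g\<close> at \<open>t\<close>, which stays in \<open>G\<close>.\<close>

lemma word_section:
  assumes "g \<in> G"
  shows "\<exists>h\<in>G. \<forall>w. g (t @ w) = g t @ h w"
  using assms
proof (induction t arbitrary: g)
  case Nil
  then show ?case by (auto simp: G_Nil)
next
  case (Cons x t)
  obtain h y where h: "h \<in> G" "\<And>w. g (x # w) = y # h w"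
    using G_Cons[OF Cons.prems] by blast
  then show ?case using Cons.IH[OF h(1)] by simp
qed

text \<open>Elements of \<open>G\<close> respect prefixes, so the letters that \<open>bact\<close>
  collects from different levels fit together. Identities for \<open>bact\<close> thereby reduce to
  identities on words, level by level.\<close>

lemma pre_bact:
  assumes "g \<in> G"
  shows "pre (bact g w) n = g (pre w n)"
proof (intro nth_equalityI)
  fix i assume "i < length (pre (bact g w) n)"
  then have i: "i < n" by simp
  then have eq: "pre w n = pre w (Suc i) @ pre (shift (Suc i) w) (n - Suc i)"
    using pre_add[of w "Suc i" "n - Suc i"] by simp
  obtain h where "g (pre w n) = g (pre w (Suc i)) @ h (pre (shift (Suc i) w) (n - Suc i))"
    using word_section[OF assms, of "pre w (Suc i)"] unfolding eq by blast
  then have "g (pre w n) ! i = g (pre w (Suc i)) ! i"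
    by (simp add: nth_append length_G[OF assms])
  then show "pre (bact g w) n ! i = g (pre w n) ! i"
    using i by (simp add: bact_def pre_def)
qed (simp add: length_G[OF assms])

lemma bact_id [simp]: "bact id w = w" for w :: "nat \<Rightarrow> 'x"
  by (intro seq_eqI) (simp add: pre_bact)

lemma bact_comp: "g \<in> G \<Longrightarrow> h \<in> G \<Longrightarrow> bact (g \<circ> h) w = bact g (bact h w)"
  by (intro seq_eqI) (simp add: pre_bact comp_in_G)

lemma bact_inv1 [simp]: "g \<in> G \<Longrightarrow> bact (inv g) (bact g w) = w"
  by (intro seq_eqI) (simp add: pre_bact inv_in_G bij_G bij_is_inj)

lemma bact_inv2 [simp]: "g \<in> G \<Longrightarrow> bact g (bact (inv g) w) = w"
  by (intro seq_eqI) (simp add: pre_bact inv_in_G bij_G bij_is_surj surj_f_inv_f)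

lemma bact_conc:
  assumes "g \<in> G"
  shows "\<exists>h\<in>G. \<forall>w. bact g (conc t w) = conc (g t) (bact h w)"
proof -
  obtain h where h: "h \<in> G" "\<And>w. g (t @ w) = g t @ h w"
    using word_section[OF assms] by blast
  have "bact g (conc t w) = conc (g t) (bact h w)" for w
  proof -
    have 1: "pre (bact g (conc t w)) (length t) = g t"
      using assms by (simp add: pre_bact)
    have "shift (length t) (bact g (conc t w)) = bact h w"
    proof (rule seq_eqI)
      fix n
      have "pre (bact g (conc t w)) (length t + n) = g (t @ pre w n)"
        unfolding pre_bact[OF assms] by (simp add: pre_add)
      then show "pre (shift (length t) (bact g (conc t w))) n = pre (bact h w) n"
        using h assms by (simp add: pre_add pre_bact)
    qed
    then show ?thesis
      using 1 conc_pre_shift[of "bact g (conc t w)" "length t"] by simp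
  qed
  then show ?thesis using h by blast
qed

section \<open>Local form of the elements near a point\<close>

definition germ :: "((nat \<Rightarrow> 'x) \<Rightarrow> nat \<Rightarrow> 'x) \<Rightarrow> 'x list \<Rightarrow> bool" where
  "germ g v \<longleftrightarrow> (\<exists>u. \<exists>\<gamma>\<in>G. \<forall>w. g (conc v w) = conc u (bact \<gamma> w))"

lemma germI: "\<gamma> \<in> G \<Longrightarrow> (\<And>w. g (conc v w) = conc u (bact \<gamma> w)) \<Longrightarrow> germ g v"
  unfolding germ_def by blast

lemma germ_extend:
  assumes "\<gamma> \<in> G" "\<And>w. g (conc v w) = conc u (bact \<gamma> w)"
  shows "\<exists>\<delta>\<in>G. \<forall>w. g (conc (v @ t) w) = conc (u @ \<gamma> t) (bact \<delta> w)"
  using bact_conc[OF assms(1), of t] assms(2) by (auto simp: conc_append)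

lemma germ_append:
  assumes "germ g v"
  shows "germ g (v @ t)"
proof -
  obtain u \<gamma> where u: "\<gamma> \<in> G" "\<And>w. g (conc v w) = conc u (bact \<gamma> w)"
    using assms unfolding germ_def by blast
  obtain \<delta> where "\<delta> \<in> G" "\<And>w. g (conc (v @ t) w) = conc (u @ \<gamma> t) (bact \<delta> w)"
    using germ_extend[OF u] by blast
  then show ?thesis by (rule germI)
qed

text \<open>Reading \<open>N\<close> more letters lengthens the source and the target word alike,
  since \<open>G\<close> preserves length; the target word is then a prefix of \<open>g p\<close>
  because \<open>p\<close> itself lies in the source cylinder.\<close>

lemma germ_deep:
  assumes "germ g (pre p k)"
  shows "\<exists>n m. \<exists>\<gamma>\<in>G. n \<ge> N \<and> m \<ge> N \<and> (\<forall>w. g (conc (pre p n) w) = conc (pre (g p) m) (bact \<gamma> w))"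
proof -
  obtain u \<gamma> where u: "\<gamma> \<in> G" "\<And>w. g (conc (pre p k) w) = conc u (bact \<gamma> w)"
    using assms unfolding germ_def by blast
  let ?t = "pre (shift k p) N"
  obtain \<delta> where d: "\<delta> \<in> G" "\<And>w. g (conc (pre p k @ ?t) w) = conc (u @ \<gamma> ?t) (bact \<delta> w)"
    using germ_extend[OF u, of ?t] by blast
  have "g p = g (conc (pre p k @ ?t) (shift (k + N) p))"
    by (simp flip: pre_add)
  then have "pre (g p) (length (u @ \<gamma> ?t)) = u @ \<gamma> ?t"
    unfolding d(2) by (metis pre_conc)
  moreover have "N \<le> length (u @ \<gamma> ?t)"
    using u(1) by (simp add: length_G)
  ultimately show ?thesis
    using d by (intro exI[of _ "k + N"] exI[of _ "length (u @ \<gamma> ?t)"] bexI[of _ \<delta>])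
      (auto simp: pre_add)
qed

text \<open>A pointwise replacement for the antichain tables in \<open>VG\<close>, shown equivalent
  in \<open>VG_iff_local_bij\<close>. Products and inverses can then be treated without refining
  antichains, and continuity need not be demanded.\<close>

definition local_bij :: "((nat \<Rightarrow> 'x) \<Rightarrow> nat \<Rightarrow> 'x) \<Rightarrow> bool" where
  "local_bij g \<longleftrightarrow> bij g \<and> (\<forall>p. \<exists>n. germ g (pre p n))"

lemma local_bij_deep:
  assumes "local_bij g"
  obtains n m \<gamma> where "\<gamma> \<in> G" "n \<ge> N" "m \<ge> N"
    "\<And>w. g (conc (pre p n) w) = conc (pre (g p) m) (bact \<gamma> w)"
proof -
  obtain k where "germ g (pre p k)" using assms unfolding local_bij_def by blast
  from germ_deep[OF this, of N] show thesis using that by blast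
qed

lemma local_bij_id [simp]: "local_bij id"
  unfolding local_bij_def by (auto intro!: exI[of _ 0] germI[of id _ _ "[]"])

lemma local_bij_comp:
  assumes g: "local_bij g" and h: "local_bij h"
  shows "local_bij (g \<circ> h)"
  unfolding local_bij_def
proof (intro conjI allI)
  show "bij (g \<circ> h)" using g h by (simp add: local_bij_def bij_comp)
  fix p
  obtain k where k: "germ g (pre (h p) k)" using g by (auto simp: local_bij_def)
  \<comment> \<open>The image prefix is taken at least as long as the word where \<open>g\<close>
    has a germ, so that the two germs compose.\<close>
  obtain n m \<gamma> where 1: "\<gamma> \<in> G" "n \<ge> k" "m \<ge> k"
    "\<And>w. h (conc (pre p n) w) = conc (pre (h p) m) (bact \<gamma> w)"
    by (rule local_bij_deep[OF h, of k p]) (rule that)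
  have "germ g (pre (h p) m)"
    using germ_append[OF k, of "pre (shift k (h p)) (m - k)"] 1(3)
    by (simp flip: pre_add)
  then obtain u \<delta> where 2: "\<delta> \<in> G" "\<And>w. g (conc (pre (h p) m) w) = conc u (bact \<delta> w)"
    unfolding germ_def by blast
  show "\<exists>n. germ (g \<circ> h) (pre p n)"
    by (rule exI[of _ n], rule germI[of "\<delta> \<circ> \<gamma>" _ _ u])
      (use 1 2 in \<open>simp_all add: comp_in_G bact_comp\<close>)
qed

text \<open>The germ of \<open>g\<close> at the preimage of \<open>p\<close>, read backwards with
  the inverse element of \<open>G\<close>, is a germ of the inverse at \<open>p\<close>.\<close>

lemma local_bij_inv:
  assumes g: "local_bij g"
  shows "local_bij (inv g)"
  unfolding local_bij_def
proof (intro conjI allI)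
  have b: "bij g" using g by (simp add: local_bij_def)
  then show "bij (inv g)" by (rule bij_imp_bij_inv)
  fix p
  obtain n m \<gamma> where 1: "\<gamma> \<in> G" "n \<ge> 0" "m \<ge> 0"
    "\<And>w. g (conc (pre (inv g p) n) w) = conc (pre (g (inv g p)) m) (bact \<gamma> w)"
    by (rule local_bij_deep[OF g, of 0 "inv g p"]) (rule that)
  have "g (inv g p) = p" using b by (simp add: bij_is_surj surj_f_inv_f)
  then have "g (conc (pre (inv g p) n) (bact (inv \<gamma>) w)) = conc (pre p m) w" for w
    using 1 by simp
  then have "inv g (conc (pre p m) w) = conc (pre (inv g p) n) (bact (inv \<gamma>) w)" for w
    using inv_f_eq[OF bij_is_inj[OF b]] by blast
  then have "germ (inv g) (pre p m)"
    by (rule germI[OF inv_in_G[OF 1(1)]])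
  then show "\<exists>n. germ (inv g) (pre p n)" ..
qed

lemma local_bij_continuous:
  assumes "local_bij g"
  shows "continuous_map cantor_top cantor_top g"
proof -
  have "openin cantor_top {p. g p i \<in> U}" for i U
  proof (rule iffD2[OF openin_subopen], rule ballI)
    fix p assume p: "p \<in> {p. g p i \<in> U}"
    \<comment> \<open>With \<open>m\<close> above \<open>i\<close>, letter \<open>i\<close> of the
      image is constant on the cylinder of \<open>pre p n\<close>.\<close>
    obtain n m \<gamma> where 1: "\<gamma> \<in> G" "n \<ge> Suc i" "m \<ge> Suc i"
      "\<And>w. g (conc (pre p n) w) = conc (pre (g p) m) (bact \<gamma> w)"
      by (rule local_bij_deep[OF assms, of "Suc i" p]) (rule that)
    have "g q i \<in> U" if "q \<in> cyl (pre p n)" for q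
    proof -
      have "g q = conc (pre (g p) m) (bact \<gamma> (shift n q))"
        using arg_cong[OF conc_shift_cyl[OF that], of g] 1(4)[of "shift n q"] by simp
      then show ?thesis using 1(3) p by (simp add: conc_nth)
    qed
    moreover have "p \<in> cyl (pre p n)" by (simp add: mem_cyl)
    ultimately show "\<exists>T. openin cantor_top T \<and> p \<in> T \<and> T \<subseteq> {p. g p i \<in> U}"
      using openin_cyl[of "pre p n"] by (intro exI[of _ "cyl (pre p n)"]) auto
  qed
  then have "continuous_map cantor_top (discrete_topology UNIV) (\<lambda>p. g p i)" for i
    unfolding continuous_map_def by auto
  then have "continuous_map cantor_top (product_topology (\<lambda>_. discrete_topology UNIV) UNIV) g"
    unfolding continuous_map_componentwise_UNIV by blast
  then show ?thesis unfolding cantor_top_def .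
qed

text \<open>For the harder direction, compactness gives a level all of whose words carry germs. This
  level serves as the first antichain; its image is again a complete antichain, because the
  bijection \<open>g\<close> takes these cylinders onto cylinders.\<close>

lemma VG_iff_local_bij: "g \<in> VG G \<longleftrightarrow> local_bij g"
proof
  assume g: "g \<in> VG G"
  then have hom: "homeomorphic_map cantor_top cantor_top g" by (simp add: VG_def)
  then have "bij g"
    using homeomorphic_imp_injective_map[OF hom] homeomorphic_imp_surjective_map[OF hom]
    by (simp add: bij_def)
  moreover have "\<exists>n. germ g (pre p n)" for p
  proof -
    obtain A1 \<alpha> gv where A: "complete_antichain A1"
      "\<And>v. v \<in> A1 \<Longrightarrow> gv v \<in> G \<and> (\<forall>w. g (conc v w) = conc (\<alpha> v) (bact (gv v) w))"
      using g unfolding VG_def by blast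
    then obtain v where v: "v \<in> A1" "p \<in> cyl v" unfolding complete_antichain_def by blast
    then have "pre p (length v) = v" by (simp add: mem_cyl)
    then have "germ g (pre p (length v))" using A(2)[OF v(1)] by (auto simp: germ_def)
    then show ?thesis by blast
  qed
  ultimately show "local_bij g" by (simp add: local_bij_def)
next
  assume g: "local_bij g"
  then have b: "bij g" by (simp add: local_bij_def)
  have hom: "homeomorphic_map cantor_top cantor_top g"
    unfolding homeomorphic_map_maps homeomorphic_maps_def
    using local_bij_continuous[OF g] local_bij_continuous[OF local_bij_inv[OF g]] b
    by (intro exI[of _ "inv g"]) (auto simp: bij_is_inj bij_is_surj surj_f_inv_f)
  obtain n where n: "\<And>v. length v = n \<Longrightarrow> germ g v"
    using uniform_length[of "germ g", OF germ_append] g unfolding local_bij_def by blast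
  define A1 where "A1 = {v :: 'x list. length v = n}"
  have "\<forall>v\<in>A1. \<exists>u \<gamma>. \<gamma> \<in> G \<and> (\<forall>w. g (conc v w) = conc u (bact \<gamma> w))"
    using n unfolding A1_def germ_def by blast
  then obtain \<alpha> gv where a: "\<And>v. v \<in> A1 \<Longrightarrow> gv v \<in> G"
    "\<And>v w. v \<in> A1 \<Longrightarrow> g (conc v w) = conc (\<alpha> v) (bact (gv v) w)"
    by metis
  have disj: "cyl u \<inter> cyl v = {}" if "u \<in> A1" "v \<in> A1" "u \<noteq> v" for u v
    using that by (auto simp: A1_def mem_cyl)
  have fin: "finite A1"
    using finite_lists_length_eq[of "UNIV :: 'x set" n] by (simp add: A1_def)
  have cover: "(\<Union>v\<in>A1. cyl v) = UNIV"
  proof -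
    have "p \<in> cyl (pre p n)" "pre p n \<in> A1" for p by (auto simp: A1_def mem_cyl)
    then show ?thesis by blast
  qed
  have ca1: "complete_antichain A1"
    using fin cover disj by (intro complete_antichainI) (auto simp: disjoint_family_on_def)
  have img: "cyl (\<alpha> v) = g ` cyl v" if v: "v \<in> A1" for v
  proof
    show "g ` cyl v \<subseteq> cyl (\<alpha> v)" using a(2)[OF v] by (auto simp: cyl_def)
    show "cyl (\<alpha> v) \<subseteq> g ` cyl v"
    proof
      fix p assume "p \<in> cyl (\<alpha> v)"
      then obtain w where "p = conc (\<alpha> v) w" by (auto simp: cyl_def)
      then have "p = g (conc v (bact (inv (gv v)) w))" using a v by simp
      then show "p \<in> g ` cyl v" by simp
    qed
  qed
  have disj2: "cyl (\<alpha> u) \<inter> cyl (\<alpha> v) = {}" if "u \<in> A1" "v \<in> A1" "u \<noteq> v" for u v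
    using disj[OF that] that b by (simp add: img bij_is_inj flip: image_Int)
  have inj: "inj_on \<alpha> A1"
  proof (rule inj_onI, rule ccontr)
    fix u v assume "u \<in> A1" "v \<in> A1" "\<alpha> u = \<alpha> v" "u \<noteq> v"
    then have "cyl (\<alpha> u) = {}" using disj2[of u v] by simp
    then show False using conc_mem_cyl by blast
  qed
  have "(\<Union>v\<in>\<alpha> ` A1. cyl v) = g ` (\<Union>v\<in>A1. cyl v)" by (auto simp: img)
  also have "\<dots> = UNIV" using cover b by (simp add: bij_is_surj)
  finally have ca2: "complete_antichain (\<alpha> ` A1)"
    using fin disj2 by (intro complete_antichainI) (auto simp: disjoint_family_on_def)
  show "g \<in> VG G"
    unfolding VG_def mem_Collect_eq
    using hom ca1 ca2 inj a by (intro conjI exI[of _ A1] exI[of _ "\<alpha> ` A1"] exI[of _ \<alpha>] exI[of _ gv])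
      (auto simp: bij_betw_def)
qed

lemma VG_bij: "g \<in> VG G \<Longrightarrow> bij g"
  by (simp add: VG_iff_local_bij local_bij_def)

lemma VG_id [simp]: "id \<in> VG G"
  by (simp add: VG_iff_local_bij)

lemma VG_comp [simp]: "g \<in> VG G \<Longrightarrow> h \<in> VG G \<Longrightarrow> g \<circ> h \<in> VG G"
  by (simp add: VG_iff_local_bij local_bij_comp)

lemma VG_inv [simp]: "g \<in> VG G \<Longrightarrow> inv g \<in> VG G"
  by (simp add: VG_iff_local_bij local_bij_inv)

lemma VG_inv_left [simp]: "g \<in> VG G \<Longrightarrow> inv g (g p) = p"
  by (simp add: VG_bij bij_is_inj)

lemma VG_inv_right [simp]: "g \<in> VG G \<Longrightarrow> g (inv g p) = p"
  by (simp add: VG_bij bij_is_surj surj_f_inv_f)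

lemma VG_inv_inv [simp]: "g \<in> VG G \<Longrightarrow> inv (inv g) = g"
  by (simp add: VG_bij inv_inv_eq)

lemma VG_inv_comp [simp]: "g \<in> VG G \<Longrightarrow> h \<in> VG G \<Longrightarrow> inv (g \<circ> h) = inv h \<circ> inv g"
  by (simp add: VG_bij o_inv_distrib)

lemma VG_eq_iff: "g \<in> VG G \<Longrightarrow> g p = g q \<longleftrightarrow> p = q"
  by (metis VG_inv_left)

lemma involution_VG:
  assumes "\<And>p. s (s p) = p" "\<And>p. \<exists>n. germ s (pre p n)"
  shows "s \<in> VG G"
  using assms by (auto simp: VG_iff_local_bij local_bij_def intro: involuntory_imp_bij)

lemma two_letters: obtains a b :: 'x where "a \<noteq> b"
proof -
  have "\<exists>a b :: 'x. a \<noteq> b"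
  proof (rule ccontr)
    assume "\<not> ?thesis"
    then have "(UNIV :: 'x set) = {undefined}" by auto
    then have "CARD('x) = 1" by (metis card_1_singleton_iff One_nat_def)
    then show False using card by simp
  qed
  then show thesis using that by blast
qed

section \<open>Swapping two cylinders\<close>

text \<open>For disjoint cylinders this is an involution, a transposition of cylinders twisted by
  \<gamma>. The twist lets it agree on \<open>cyl v\<close> with a prescribed element of the
  group.\<close>

definition swp :: "'x list \<Rightarrow> 'x list \<Rightarrow> ('x list \<Rightarrow> 'x list) \<Rightarrow> (nat \<Rightarrow> 'x) \<Rightarrow> nat \<Rightarrow> 'x" where
  "swp v u \<gamma> p =
     (if p \<in> cyl v then conc u (bact \<gamma> (shift (length v) p))
      else if p \<in> cyl u then conc v (bact (inv \<gamma>) (shift (length u) p))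
      else p)"

lemma swp_left [simp]: "swp v u \<gamma> (conc v w) = conc u (bact \<gamma> w)"
  by (simp add: swp_def)

lemma swp_right: "cyl v \<inter> cyl u = {} \<Longrightarrow> swp v u \<gamma> (conc u w) = conc v (bact (inv \<gamma>) w)"
  using conc_mem_cyl[of u w] by (auto simp: swp_def)

lemma swp_other: "p \<notin> cyl v \<Longrightarrow> p \<notin> cyl u \<Longrightarrow> swp v u \<gamma> p = p"
  by (simp add: swp_def)

lemma swp_cases:
  obtains (left) w where "p = conc v w" | (right) w where "p = conc u w"
  | (other) "p \<notin> cyl v" "p \<notin> cyl u"
  unfolding cyl_def by blast

lemma swp_swp:
  assumes "cyl v \<inter> cyl u = {}" "\<gamma> \<in> G"
  shows "swp v u \<gamma> (swp v u \<gamma> p) = p"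
  by (cases rule: swp_cases[where p = p and v = v and u = u]) (use assms in \<open>simp_all add: swp_right swp_other\<close>)

lemma swp_cyl_iff:
  assumes "cyl v \<inter> cyl u = {}" "\<gamma> \<in> G"
  shows "swp v u \<gamma> p \<in> cyl u \<longleftrightarrow> p \<in> cyl v"
  by (cases rule: swp_cases[where p = p and v = v and u = u])
    (use assms conc_mem_cyl in \<open>auto simp: swp_right swp_other disjoint_iff\<close>)

lemma swp_VG:
  assumes "cyl v \<inter> cyl u = {}" "\<gamma> \<in> G"
  shows "swp v u \<gamma> \<in> VG G"
proof (rule involution_VG)
  show "swp v u \<gamma> (swp v u \<gamma> p) = p" for p by (rule swp_swp[OF assms])
  show "\<exists>n. germ (swp v u \<gamma>) (pre p n)" for p
  proof (cases rule: swp_cases[where p = p and v = v and u = u])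
    case (left w)
    have "germ (swp v u \<gamma>) (pre p (length v))"
      using left assms by (intro germI[of \<gamma> _ _ u]) auto
    then show ?thesis ..
  next
    case (right w)
    have "germ (swp v u \<gamma>) (pre p (length u))"
      using right assms by (intro germI[of "inv \<gamma>" _ _ v]) (auto simp: swp_right inv_in_G)
    then show ?thesis ..
  next
    case other
    \<comment> \<open>A prefix of this length decides membership in both cylinders, so a whole
      neighbourhood of \<open>p\<close> is fixed.\<close>
    let ?n = "max (length v) (length u)"
    have "germ (swp v u \<gamma>) (pre p ?n)"
    proof (intro germI[of id _ _ "pre p ?n"])
      fix w
      have "pre (conc (pre p ?n) w) ?n = pre p ?n" by simp
      then have "pre (conc (pre p ?n) w) (length v) = pre p (length v)"
        "pre (conc (pre p ?n) w) (length u) = pre p (length u)"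
        by (rule pre_eq_mono, simp)+
      then show "swp v u \<gamma> (conc (pre p ?n) w) = conc (pre p ?n) (bact id w)"
        using other by (subst swp_other) (auto simp: mem_cyl)
    qed simp
    then show ?thesis ..
  qed
qed

text \<open>Words with different first letters have disjoint cylinders, which a swap exchanges.
  Words with the same first letter are linked through the cylinder of another letter.\<close>

lemma cyl_transitive:
  assumes "w \<noteq> []" "v \<noteq> []"
  shows "\<exists>h\<in>VG G. \<forall>p. h p \<in> cyl v \<longleftrightarrow> p \<in> cyl w"
proof -
  have *: "\<exists>h\<in>VG G. \<forall>p. h p \<in> cyl v \<longleftrightarrow> p \<in> cyl w" if "w \<noteq> []" "v \<noteq> []" "hd w \<noteq> hd v" for w v
  proof -
    have "cyl w \<inter> cyl v = {}"
      using that by (intro cyl_disjoint_nth[of 0]) (auto simp: hd_conv_nth)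
    then show ?thesis
      by (intro bexI[of _ "swp w v id"]) (auto simp: swp_cyl_iff swp_VG)
  qed
  show ?thesis
  proof (cases "hd w = hd v")
    case True
    obtain c where c: "c \<noteq> hd w" using two_letters by metis
    obtain h k where "h \<in> VG G" "\<forall>p. h p \<in> cyl [c] \<longleftrightarrow> p \<in> cyl w"
      "k \<in> VG G" "\<forall>p. k p \<in> cyl v \<longleftrightarrow> p \<in> cyl [c]"
      using *[of w "[c]"] *[of "[c]" v] assms c True by auto
    then show ?thesis by (intro bexI[of _ "k \<circ> h"]) auto
  qed (use * assms in blast)
qed

text \<open>For a letter \<open>x\<close>, exchanging \<open>yw\<close> with \<open>xyw\<close> for all letters \<open>y \<noteq> x\<close>
  moves the complement of the cylinder of \<open>x\<close> into that cylinder.\<close>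

lemma complement_into_cyl:
  assumes "z \<noteq> []" "w \<noteq> []"
  shows "\<exists>k\<in>VG G. \<forall>p. p \<notin> cyl z \<longrightarrow> k p \<in> cyl w"
proof -
  obtain x :: 'x where True by blast
  define k where "k p = (if p 0 \<noteq> x then conc [x] p else if p 1 \<noteq> x then shift 1 p else p)"
    for p :: "nat \<Rightarrow> 'x"
  have c: "conc [x] p 0 = x" "conc [x] p (Suc 0) = p 0" "shift (Suc 0) (conc [x] p) = p"
    "shift (Suc 0) p 0 = p (Suc 0)" for p
    using shift_conc[of "[x]" p] by (auto simp: conc_def shift_def)
  have x: "conc [x] (shift (Suc 0) p) = p" if "p 0 = x" for p
    using conc_shift_cyl[of p "[x]"] that by (simp add: cyl_Cons_iff)
  have k: "k \<in> VG G"
  proof (rule involution_VG)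
    show "k (k p) = p" for p
      by (auto simp: k_def c x)
    show "\<exists>n. germ k (pre p n)" for p
    proof -
      \<comment> \<open>The first two letters decide which branch of \<open>k\<close>
        applies.\<close>
      let ?v = "pre p 2"
      have v: "?v = [p 0, p 1]" by (simp add: pre_Suc numeral_2_eq_2)
      have e: "conc ?v w 0 = p 0" "conc ?v w 1 = p 1" for w
        by (auto simp: v conc_def)
      have s: "shift 1 (conc ?v w) = conc [p 1] w" for w
        by (auto simp: v conc_def shift_def fun_eq_iff)
      have "germ k ?v"
      proof (cases "p 0 = x")
        case False
        then show ?thesis
          by (intro germI[of id _ _ "[x] @ ?v"]) (auto simp: k_def e conc_append simp del: append_Cons)
      next
        case True
        show ?thesis
        proof (cases "p 1 = x")
          case False
          then show ?thesis
            using True e s by (intro germI[of id _ _ "[p 1]"]) (auto simp: k_def)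
        next
          case 2: True
          then show ?thesis
            using True e by (intro germI[of id _ _ ?v]) (auto simp: k_def)
        qed
      qed
      then show ?thesis ..
    qed
  qed
  have kx: "k p \<in> cyl [x]" if "p \<notin> cyl [x]" for p
    using that by (auto simp: cyl_Cons_iff k_def c)
  \<comment> \<open>Here \<open>g\<close> turns the complement of \<open>cyl z\<close> into that of
    \<open>cyl [x]\<close>, \<open>k\<close> moves it into \<open>cyl [x]\<close>, and
    \<open>h\<close> carries it on into \<open>cyl w\<close>.\<close>
  obtain g h where "g \<in> VG G" "\<forall>p. g p \<in> cyl [x] \<longleftrightarrow> p \<in> cyl z"
    "h \<in> VG G" "\<forall>p. h p \<in> cyl w \<longleftrightarrow> p \<in> cyl [x]"
    using cyl_transitive[of z "[x]"] cyl_transitive[of "[x]" w] assms by auto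
  then show ?thesis
    using k kx by (intro bexI[of _ "h \<circ> k \<circ> g"]) auto
qed

lemma moved_cyl:
  assumes "h \<in> VG G" "h \<noteq> id"
  obtains u v \<gamma> where "\<gamma> \<in> G" "length u \<ge> 2" "length v \<ge> 2" "cyl u \<inter> cyl v = {}"
    "\<And>w. h (conc u w) = conc v (bact \<gamma> w)"
proof -
  obtain p where "h p \<noteq> p" using assms(2) by (auto simp: fun_eq_iff)
  then obtain i where i: "h p i \<noteq> p i" by (auto simp: fun_eq_iff)
  have loc: "local_bij h" using assms(1) by (simp add: VG_iff_local_bij)
  \<comment> \<open>The bound \<open>i + 2\<close> puts the differing position \<open>i\<close>
    inside both prefixes and makes them at least two letters long, which leaves room for a third
    cylinder in \<open>VG_product_of_small\<close>.\<close>
  obtain n m \<gamma> where 1: "\<gamma> \<in> G" "n \<ge> i + 2" "m \<ge> i + 2"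
    "\<And>w. h (conc (pre p n) w) = conc (pre (h p) m) (bact \<gamma> w)"
    by (rule local_bij_deep[OF loc, of "i + 2" p]) (rule that)
  have "cyl (pre p n) \<inter> cyl (pre (h p) m) = {}"
    using 1 i by (intro cyl_disjoint_nth[of i]) auto
  then show thesis using 1 by (intro that[of \<gamma> "pre p n" "pre (h p) m"]) auto
qed

definition small :: "((nat \<Rightarrow> 'x) \<Rightarrow> nat \<Rightarrow> 'x) \<Rightarrow> bool" where
  "small f \<longleftrightarrow> f \<in> VG G \<and> (\<exists>z. z \<noteq> [] \<and> (\<forall>p\<in>cyl z. f p = p))"

lemma small_VG: "small f \<Longrightarrow> f \<in> VG G"
  by (simp add: small_def)

text \<open>A swap that agrees with \<open>h\<close> on a cylinder moved off itself is small, as it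
  fixes a third cylinder; composed with \<open>h\<close> it fixes the moved cylinder.\<close>

lemma VG_product_of_small:
  assumes h: "h \<in> VG G"
  obtains s t where "small s" "small t" "h = s \<circ> t"
proof (cases "h = id")
  case True
  \<comment> \<open>The identity fixes every cylinder, so an arbitrary letter will do.\<close>
  have "small id" unfolding small_def by (auto intro: exI[of _ "[undefined]"])
  then show thesis using that[of id id] True by simp
next
  case False
  obtain u v \<gamma> where 1: "\<gamma> \<in> G" "length u \<ge> 2" "length v \<ge> 2" "cyl u \<inter> cyl v = {}"
    "\<And>w. h (conc u w) = conc v (bact \<gamma> w)"
    by (rule moved_cyl[OF h False]) (rule that)
  obtain a b :: 'x where "a \<noteq> b" by (rule two_letters)
  then have "\<exists>z. length z = 2 \<and> z \<noteq> take 2 u \<and> z \<noteq> take 2 v"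
  proof -
    \<comment> \<open>Three words of length two cannot all be among the two prefixes of
      \<open>u\<close> and \<open>v\<close>; a remaining one gives the third cylinder.\<close>
    have "card {[a, a], [a, b], [b, a]} = 3" using \<open>a \<noteq> b\<close> by simp
    moreover have "card {take 2 u, take 2 v} \<le> 2" by (simp add: card_insert_if)
    ultimately have "\<not> {[a, a], [a, b], [b, a]} \<subseteq> {take 2 u, take 2 v}"
      using card_mono[of "{take 2 u, take 2 v}" "{[a, a], [a, b], [b, a]}"]
      by (metis finite.emptyI finite_insert not_less_eq_eq numeral_2_eq_2 numeral_3_eq_3 order_trans order_refl)
    then obtain z where "z \<in> {[a, a], [a, b], [b, a]}" "z \<notin> {take 2 u, take 2 v}" by blast
    then show ?thesis by (intro exI[of _ z]) auto
  qed
  then obtain z where z: "length z = 2" "z \<noteq> take 2 u" "z \<noteq> take 2 v" by blast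
  have "p \<notin> cyl u \<and> p \<notin> cyl v" if "p \<in> cyl z" for p
  proof -
    have "pre p 2 = z" using that z(1) by (simp add: mem_cyl)
    moreover have "pre p 2 = take 2 t" if "p \<in> cyl t" "length t \<ge> 2" for t
      using that take_pre[of 2 "length t" p] by (simp add: mem_cyl)
    ultimately show ?thesis using z 1 by blast
  qed
  then have "small (swp u v \<gamma>)"
    unfolding small_def using swp_VG[OF 1(4,1)] z(1)
    by (auto intro!: exI[of _ z] simp: swp_other)
  moreover have "small (swp u v \<gamma> \<circ> h)"
    unfolding small_def
  proof (intro conjI exI[of _ u] ballI)
    show "swp u v \<gamma> \<circ> h \<in> VG G" using swp_VG[OF 1(4,1)] h by simp
    show "u \<noteq> []" using 1(2) by auto
    fix p assume "p \<in> cyl u"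
    then obtain w where "p = conc u w" by (auto simp: cyl_def)
    then show "(swp u v \<gamma> \<circ> h) p = p" using 1 by (simp add: swp_right)
  qed
  moreover have "h = swp u v \<gamma> \<circ> (swp u v \<gamma> \<circ> h)"
    using swp_swp[OF 1(4,1)] by auto
  ultimately show thesis by (rule that)
qed

section \<open>The derived subgroup\<close>

definition comm where
  "comm f g = f \<circ> g \<circ> inv f \<circ> inv g" for f g :: "(nat \<Rightarrow> 'x) \<Rightarrow> nat \<Rightarrow> 'x"

definition supported where
  "supported f A \<longleftrightarrow> (\<forall>p. p \<notin> A \<longrightarrow> f p = p)" for f :: "(nat \<Rightarrow> 'x) \<Rightarrow> nat \<Rightarrow> 'x"

lemma comm_VG [simp]: "f \<in> VG G \<Longrightarrow> g \<in> VG G \<Longrightarrow> comm f g \<in> VG G"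
  by (simp add: comm_def)

text \<open>If \<open>f p\<close> were outside \<open>A\<close>, it would be fixed by
  \<open>f\<close>, and injectivity would give \<open>f p = p\<close>.\<close>

lemma supported_image: "f \<in> VG G \<Longrightarrow> supported f A \<Longrightarrow> p \<in> A \<Longrightarrow> f p \<in> A"
  unfolding supported_def by (metis VG_eq_iff)

lemma supported_commute:
  assumes "f \<in> VG G" "g \<in> VG G" "supported f A" "supported g B" "A \<inter> B = {}"
  shows "f (g p) = g (f p)"
proof -
  have "f p \<in> A" if "p \<in> A" using supported_image assms that by blast
  moreover have "g p \<in> B" if "p \<in> B" using supported_image assms that by blast
  ultimately show ?thesis
    using assms(3-5) unfolding supported_def by (metis disjoint_iff)
qed

lemma supported_mono: "supported f A \<Longrightarrow> A \<subseteq> B \<Longrightarrow> supported f B"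
  by (auto simp: supported_def)

lemma supported_comp: "supported f A \<Longrightarrow> supported g A \<Longrightarrow> supported (f \<circ> g) A"
  by (auto simp: supported_def)

lemma supported_inv: "f \<in> VG G \<Longrightarrow> supported f A \<Longrightarrow> supported (inv f) A"
  unfolding supported_def by (metis VG_inv_left)

lemma supported_conj:
  assumes "f \<in> VG G" "h \<in> VG G" "supported f A" "\<And>p. p \<in> A \<Longrightarrow> h p \<in> B"
  shows "supported (h \<circ> f \<circ> inv h) B"
  unfolding supported_def
proof (intro allI impI)
  fix p assume "p \<notin> B"
  then have "inv h p \<notin> A" using assms(2) assms(4)[of "inv h p"] by auto
  then show "(h \<circ> f \<circ> inv h) p = p" using assms by (simp add: supported_def)
qed

section \<open>Group structure and commutators\<close>

lemma group_VG: "group (VG_group G)"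
proof (rule groupI)
  fix f assume "f \<in> carrier (VG_group G)"
  then show "\<exists>g\<in>carrier (VG_group G). g \<otimes>\<^bsub>VG_group G\<^esub> f = \<one>\<^bsub>VG_group G\<^esub>"
    by (intro bexI[of _ "inv f"]) (auto simp: VG_group_def)
qed (auto simp: VG_group_def)

lemma m_inv_VG: "f \<in> VG G \<Longrightarrow> m_inv (VG_group G) f = inv f"
  by (rule group.inv_equality[OF group_VG]) (auto simp: VG_group_def)

definition D where "D = derived (VG_group G) (carrier (VG_group G))"

lemma subgroup_D: "subgroup D (VG_group G)"
  unfolding D_def by (rule group.derived_is_subgroup[OF group_VG]) simp

lemma D_VG: "d \<in> D \<Longrightarrow> d \<in> VG G"
  using subgroup.mem_carrier[OF subgroup_D] by (simp add: VG_group_def)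

lemma D_comp: "d \<in> D \<Longrightarrow> e \<in> D \<Longrightarrow> d \<circ> e \<in> D"
  using subgroup.m_closed[OF subgroup_D] by (simp add: VG_group_def)

lemma commutator_eq:
  "f \<in> VG G \<Longrightarrow> g \<in> VG G \<Longrightarrow>
    f \<otimes>\<^bsub>VG_group G\<^esub> g \<otimes>\<^bsub>VG_group G\<^esub> m_inv (VG_group G) f \<otimes>\<^bsub>VG_group G\<^esub> m_inv (VG_group G) g = comm f g"
  by (simp only: m_inv_VG) (simp add: VG_group_def comm_def)

lemma derived_set_VG: "derived_set (VG_group G) (carrier (VG_group G)) = {comm f g | f g. f \<in> VG G \<and> g \<in> VG G}"
proof -
  have "carrier (VG_group G) = VG G" by (simp add: VG_group_def)
  then show ?thesis using commutator_eq by force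
qed

lemma comm_D: "f \<in> VG G \<Longrightarrow> g \<in> VG G \<Longrightarrow> comm f g \<in> D"
  unfolding D_def derived_def derived_set_VG by (rule generate.incl) blast

lemma D_conj: "h \<in> VG G \<Longrightarrow> d \<in> D \<Longrightarrow> h \<circ> d \<circ> inv h \<in> D"
proof -
  assume h: "h \<in> VG G" and d: "d \<in> D"
  have "h \<circ> d \<circ> inv h = comm h d \<circ> d"
    using h D_VG[OF d] by (auto simp: comm_def)
  then show ?thesis using D_comp comm_D h d D_VG by simp
qed

lemma D_least:
  assumes "subgroup N (VG_group G)" "\<And>f g. f \<in> VG G \<Longrightarrow> g \<in> VG G \<Longrightarrow> comm f g \<in> N"
  shows "D \<subseteq> N"
  unfolding D_def derived_def derived_set_VG
  by (rule group.generate_subgroup_incl[OF group_VG]) (use assms in auto)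

lemma D_nontrivial: "\<exists>d\<in>D. d \<noteq> id"
proof -
  obtain a b :: 'x where ab: "a \<noteq> b" by (rule two_letters)
  have disj: "cyl [a, a] \<inter> cyl [a, b] = {}" "cyl [a, b] \<inter> cyl [b] = {}" "cyl [a, a] \<inter> cyl [b] = {}"
    using ab by (auto simp: cyl_Cons_iff)
  \<comment> \<open>Two transpositions sharing one cylinder: their commutator permutes the three
    cylinders cyclically, so it moves the constant sequence \<open>a\<close> into
    \<open>cyl [b]\<close>.\<close>
  let ?f = "swp [a, a] [a, b] id" and ?g = "swp [a, b] [b] id"
  have V: "?f \<in> VG G" "?g \<in> VG G" using disj by (auto intro: swp_VG)
  let ?p = "\<lambda>_. a"
  have "?p = conc [a, a] ?p" by (auto simp: conc_def nth_Cons split: nat.splits)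
  then obtain p where p: "p = conc [a, a] ?p" by blast
  have g: "?g p = p"
    unfolding p using disj conc_mem_cyl by (intro swp_other) blast+
  then have "inv ?g p = p" using V by (metis VG_inv_left)
  moreover have f: "?f p = conc [a, b] ?p" unfolding p by simp
  moreover have "inv ?f p = ?f p"
    using V(1) swp_swp[OF disj(1), of id p] by (metis VG_inv_left id_in_G)
  moreover have "?g (?f p) = conc [b] ?p" unfolding f by simp
  moreover have "?f (conc [b] ?p) = conc [b] ?p"
    using disj conc_mem_cyl by (intro swp_other) blast+
  ultimately have "comm ?f ?g p = conc [b] ?p" by (simp add: comm_def)
  moreover have "p 0 = a" "conc [b] ?p 0 = b" by (auto simp: p conc_def)
  ultimately have "comm ?f ?g \<noteq> id" using ab by (metis id_apply)
  then show ?thesis using comm_D V by blast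
qed

text \<open>Modulo \<open>D\<close>, an element fixing a cylinder can be replaced by a conjugate fixing
  any other given cylinder.\<close>

lemma D_approximates:
  assumes w: "w \<noteq> []" and h: "h \<in> VG G"
  shows "\<exists>d\<in>D. \<forall>p\<in>cyl w. d p = h p"
proof -
  have *: "\<exists>d\<in>D. \<exists>c\<in>VG G. s = d \<circ> c \<and> (\<forall>p\<in>cyl w. c p = p)" if s: "small s" for s
  proof -
    obtain z where z: "z \<noteq> []" "\<forall>p\<in>cyl z. s p = p" and sV: "s \<in> VG G"
      using s by (auto simp: small_def)
    obtain k where k: "k \<in> VG G" "\<forall>p. k p \<in> cyl w \<longleftrightarrow> p \<in> cyl z"
      using cyl_transitive[OF z(1) w] by blast
    have "(k \<circ> s \<circ> inv k) p = p" if "p \<in> cyl w" for p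
    proof -
      have "inv k p \<in> cyl z" using k that by (metis VG_inv_right)
      then show ?thesis using z k by simp
    qed
    moreover have "s = comm s k \<circ> (k \<circ> s \<circ> inv k)"
      using sV k by (auto simp: comm_def)
    moreover have "k \<circ> s \<circ> inv k \<in> VG G" using sV k by simp
    ultimately show ?thesis using comm_D[OF sV k(1)] by blast
  qed
  obtain s t where st: "small s" "small t" "h = s \<circ> t"
    by (rule VG_product_of_small[OF h])
  obtain d c e b where 1: "d \<in> D" "c \<in> VG G" "s = d \<circ> c" "\<forall>p\<in>cyl w. c p = p"
    "e \<in> D" "b \<in> VG G" "t = e \<circ> b" "\<forall>p\<in>cyl w. b p = p"
    using *[OF st(1)] *[OF st(2)] by blast
  \<comment> \<open>From \<open>h = d \<circ> c \<circ> e \<circ> b\<close>: on \<open>cyl w\<close>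
    the factor \<open>b\<close> drops out, and \<open>c\<close> can be cancelled on the right of
    \<open>e\<close> since it fixes these points.\<close>
  have "d \<circ> (c \<circ> e \<circ> inv c) \<in> D" using 1 D_comp D_conj by blast
  moreover have "(d \<circ> (c \<circ> e \<circ> inv c)) p = h p" if "p \<in> cyl w" for p
  proof -
    have "inv c p = p" using 1(2,4) that by (metis VG_inv_left)
    then show ?thesis using 1(8) that by (simp add: st(3) 1(3,7))
  qed
  ultimately show ?thesis by blast
qed

end

section \<open>Normal subgroups of the derived subgroup\<close>

locale normal_in_derived = self_similar_group G
  for G :: "('x::finite list \<Rightarrow> 'x list) set" +
  fixes N :: "((nat \<Rightarrow> 'x) \<Rightarrow> nat \<Rightarrow> 'x) set"
  assumes normal_N: "normal N ((VG_group G)\<lparr>carrier := D\<rparr>)" and nontrivial_N: "N \<noteq> {id}"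
begin

lemma subgroup_N: "subgroup N (VG_group G)"
  using group.incl_subgroup[OF group_VG subgroup_D normal_imp_subgroup[OF normal_N]] .

lemma N_D: "x \<in> N \<Longrightarrow> x \<in> D"
  using subgroup.subset[OF normal_imp_subgroup[OF normal_N]] by auto

lemma N_VG: "x \<in> N \<Longrightarrow> x \<in> VG G"
  by (rule D_VG[OF N_D])

lemma N_comp: "x \<in> N \<Longrightarrow> y \<in> N \<Longrightarrow> x \<circ> y \<in> N"
  using subgroup.m_closed[OF subgroup_N] by (simp add: VG_group_def)

lemma N_inv: "x \<in> N \<Longrightarrow> inv x \<in> N"
  using subgroup.m_inv_closed[OF subgroup_N, of x] by (simp add: m_inv_VG N_VG)

lemma N_conj:
  assumes "d \<in> D" "x \<in> N"
  shows "d \<circ> x \<circ> inv d \<in> N"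
proof -
  have "m_inv ((VG_group G)\<lparr>carrier := D\<rparr>) d = inv d"
    using group.m_inv_consistent[OF group_VG subgroup_D assms(1)] assms(1)
    by (simp add: m_inv_VG D_VG)
  then show ?thesis
    using normal.inv_op_closed2[OF normal_N, of d x] assms by (simp add: VG_group_def)
qed

text \<open>If \<open>n\<close> moves a set off itself and \<open>g\<close> is supported there, then \<open>[g, n]\<close> acts on that set
  as \<open>g\<close>; correcting \<open>f\<close> and \<open>g\<close> to elements of \<open>D\<close> with disjoint supports of the corrections
  leaves their commutator unchanged.\<close>

lemma local_commutators_in_N:
  "\<exists>w. w \<noteq> [] \<and> (\<forall>f\<in>VG G. \<forall>g\<in>VG G. supported f (cyl w) \<longrightarrow> supported g (cyl w) \<longrightarrow> comm g f \<in> N)"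
proof -
  have "id \<in> N" using subgroup.one_closed[OF subgroup_N] by (simp add: VG_group_def)
  then obtain n where n: "n \<in> N" "n \<noteq> id" using nontrivial_N by blast
  note nV = N_VG[OF n(1)]
  obtain u v \<gamma> where 1: "\<gamma> \<in> G" "length u \<ge> 2" "length v \<ge> 2" "cyl u \<inter> cyl v = {}"
    "\<And>w. n (conc u w) = conc v (bact \<gamma> w)"
    by (rule moved_cyl[OF nV n(2)]) (rule that)
  have n_u: "n p \<in> cyl v" if "p \<in> cyl u" for p
    using that 1(5) by (auto simp: cyl_def)
  obtain a b :: 'x where ab: "a \<noteq> b" by (rule two_letters)
  \<comment> \<open>Three disjoint cylinders inside \<open>cyl u\<close>: the first carries
    \<open>f\<close> and \<open>g\<close>, the second the correction of \<open>g\<close>, the third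
    the correction of \<open>f\<close>.\<close>
  let ?w = "u @ [a, a]" and ?k = "swp (u @ [a, a]) (u @ [a, b]) id" and ?h = "swp (u @ [a, a]) (u @ [b]) id"
  have disj: "cyl (u @ [a, a]) \<inter> cyl (u @ [a, b]) = {}" "cyl (u @ [a, b]) \<inter> cyl (u @ [b]) = {}"
    "cyl (u @ [a, a]) \<inter> cyl (u @ [b]) = {}"
    using ab by (auto intro!: cyl_append_disjoint simp: cyl_Cons_iff)
  have sub: "cyl (u @ t) \<subseteq> cyl u" for t using cyl_append_subset by blast
  have V: "?k \<in> VG G" "?h \<in> VG G" using disj by (auto intro: swp_VG)
  have "comm g f \<in> N" if fg: "f \<in> VG G" "g \<in> VG G" "supported f (cyl ?w)" "supported g (cyl ?w)" for f g
  proof -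
    \<comment> \<open>Chosen so that \<open>f \<circ> e\<close> is the commutator of
      \<open>f\<close> and \<open>?h\<close>, and likewise \<open>g \<circ> c\<close> that of
      \<open>g\<close> and \<open>?k\<close>; both products lie in \<open>D\<close>.\<close>
    define e where "e = ?h \<circ> inv f \<circ> inv ?h"
    define c where "c = ?k \<circ> inv g \<circ> inv ?k"
    \<comment> \<open>What is left of the commutator of \<open>g \<circ> c\<close> and
      \<open>n\<close> after splitting off \<open>g\<close>. It lives on the support of
      \<open>c\<close> and on \<open>cyl v\<close>, away from \<open>f\<close> and
      \<open>e\<close>.\<close>
    define y where "y = c \<circ> (n \<circ> inv (g \<circ> c) \<circ> inv n)"
    have VV: "e \<in> VG G" "c \<in> VG G" "y \<in> VG G"
      using V fg nV by (auto simp: e_def c_def y_def)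
    have e: "supported e (cyl (u @ [b]))"
      unfolding e_def using disj fg V
      by (intro supported_conj[where A = "cyl ?w"] supported_inv) (auto simp: swp_cyl_iff)
    have c: "supported c (cyl (u @ [a, b]))"
      unfolding c_def using disj fg V
      by (intro supported_conj[where A = "cyl ?w"] supported_inv) (auto simp: swp_cyl_iff)
    have "supported (g \<circ> c) (cyl u)"
      using supported_mono[OF c sub] supported_mono[OF fg(4) sub] by (intro supported_comp)
    then have "supported (n \<circ> inv (g \<circ> c) \<circ> inv n) (cyl v)"
      using fg VV nV n_u by (intro supported_conj[where A = "cyl u"] supported_inv) auto
    then have y: "supported y (cyl (u @ [a, b]) \<union> cyl v)"
      using c unfolding y_def supported_def by (metis UnI1 UnI2 comp_apply)
    have dj: "(cyl (u @ [a, b]) \<union> cyl v) \<inter> cyl ?w = {}" "(cyl (u @ [a, b]) \<union> cyl v) \<inter> cyl (u @ [b]) = {}"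
      "cyl (u @ [b]) \<inter> cyl ?w = {}"
      using disj sub 1(4) by blast+
    have yf: "y (f p) = f (y p)" and ye: "y (e p) = e (y p)" and eg: "e (inv g p) = inv g (e p)" for p
      using supported_commute[OF _ _ y fg(3) dj(1)] supported_commute[OF _ _ y e dj(2)]
        supported_commute[OF _ _ e supported_inv[OF fg(2,4)] dj(3)] VV fg by auto
    have "comm g ?k \<in> D" "comm f ?h \<in> D" using fg V comm_D by auto
    moreover have "comm g ?k = g \<circ> c" "comm f ?h = f \<circ> e"
      by (auto simp: comm_def c_def e_def)
    ultimately have gD: "g \<circ> c \<in> D" and fD: "f \<circ> e \<in> D" by simp_all
    have "comm (g \<circ> c) n = ((g \<circ> c) \<circ> n \<circ> inv (g \<circ> c)) \<circ> inv n"
      by (simp add: comm_def comp_assoc)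
    then have xN: "comm (g \<circ> c) n \<in> N"
      using N_comp[OF N_conj[OF gD n(1)] N_inv[OF n(1)]] by simp
    have x: "comm (g \<circ> c) n = g \<circ> y"
      by (auto simp: comm_def y_def)
    have "comm (g \<circ> y) (f \<circ> e) = (g \<circ> y) \<circ> ((f \<circ> e) \<circ> inv (g \<circ> y) \<circ> inv (f \<circ> e))"
      by (simp add: comm_def comp_assoc)
    then have "comm (g \<circ> y) (f \<circ> e) \<in> N"
      using N_comp[OF xN N_conj[OF fD N_inv[OF xN]]] x by simp
    \<comment> \<open>As \<open>y\<close> commutes with \<open>f\<close> and \<open>e\<close>, and
      \<open>e\<close> with \<open>g\<close>, both corrections cancel.\<close>
    moreover have "comm (g \<circ> y) (f \<circ> e) = comm g f"
      using fg VV by (auto simp: comm_def yf ye eg)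
    ultimately show ?thesis by simp
  qed
  then show ?thesis by (intro exI[of _ ?w]) auto
qed

section \<open>The normal core of \<open>N\<close> in the whole group\<close>

definition M where "M = {x \<in> VG G. \<forall>h\<in>VG G. h \<circ> x \<circ> inv h \<in> N}"

lemma M_VG: "x \<in> M \<Longrightarrow> x \<in> VG G"
  by (simp add: M_def)

lemma M_N: "x \<in> M \<Longrightarrow> x \<in> N"
  unfolding M_def using VG_id by fastforce

lemma M_comp:
  assumes "x \<in> M" "y \<in> M"
  shows "x \<circ> y \<in> M"
  unfolding M_def
proof (intro CollectI conjI ballI)
  fix h assume h: "h \<in> VG G"
  have "h \<circ> (x \<circ> y) \<circ> inv h = (h \<circ> x \<circ> inv h) \<circ> (h \<circ> y \<circ> inv h)"
    using h by auto
  then show "h \<circ> (x \<circ> y) \<circ> inv h \<in> N" using assms h N_comp unfolding M_def by fastforce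
qed (use assms M_VG in simp)

lemma M_inv:
  assumes "x \<in> M"
  shows "inv x \<in> M"
  unfolding M_def
proof (intro CollectI conjI ballI)
  fix h assume h: "h \<in> VG G"
  have "h \<circ> inv x \<circ> inv h = inv (h \<circ> x \<circ> inv h)"
    using h M_VG[OF assms] by (simp add: comp_assoc)
  then show "h \<circ> inv x \<circ> inv h \<in> N" using assms h N_inv unfolding M_def by fastforce
qed (use assms M_VG in simp)

text \<open>The gain over \<open>N\<close>, for which \<open>N_conj\<close> allows only conjugation
  by elements of \<open>D\<close>.\<close>

lemma M_conj:
  assumes "x \<in> M" "k \<in> VG G"
  shows "k \<circ> x \<circ> inv k \<in> M"
  unfolding M_def
proof (intro CollectI conjI ballI)
  fix h assume h: "h \<in> VG G"
  have eq: "h \<circ> (k \<circ> x \<circ> inv k) \<circ> inv h = (h \<circ> k) \<circ> x \<circ> inv (h \<circ> k)"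
    using h assms by (simp add: comp_assoc)
  show "h \<circ> (k \<circ> x \<circ> inv k) \<circ> inv h \<in> N"
    unfolding eq using assms VG_comp[OF h] unfolding M_def by blast
qed (use assms M_VG in simp)

text \<open>Inside \<open>cyl w\<close>, conjugation by any \<open>h\<close> can be imitated by an
  element of \<open>D\<close>, so \<open>N\<close> contains all conjugates of the commutator. The
  general case is carried there by an element taking the complement of \<open>cyl z\<close> into
  \<open>cyl w\<close>.\<close>

lemma comm_common_fix_in_M:
  assumes fg: "f \<in> VG G" "g \<in> VG G" and z: "z \<noteq> []" "\<And>p. p \<in> cyl z \<Longrightarrow> f p = p" "\<And>p. p \<in> cyl z \<Longrightarrow> g p = p"
  shows "comm f g \<in> M"
proof -
  obtain w where w: "w \<noteq> []"
    "\<And>f g. f \<in> VG G \<Longrightarrow> g \<in> VG G \<Longrightarrow> supported f (cyl w) \<Longrightarrow> supported g (cyl w) \<Longrightarrow> comm f g \<in> N"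
    using local_commutators_in_N by blast
  have local: "comm f g \<in> M"
    if fg: "f \<in> VG G" "g \<in> VG G" "supported f (cyl w)" "supported g (cyl w)" for f g
    unfolding M_def
  proof (intro CollectI conjI ballI)
    fix h assume h: "h \<in> VG G"
    let ?x = "comm f g"
    obtain d where d: "d \<in> D" "\<And>p. p \<in> cyl w \<Longrightarrow> d p = h p"
      using D_approximates[OF w(1) h] by blast
    note dV = D_VG[OF d(1)]
    have xV: "?x \<in> VG G" using fg by simp
    have xs: "supported ?x (cyl w)"
      unfolding comm_def using fg by (intro supported_comp supported_inv)
    \<comment> \<open>A conjugate depends only on the values of the conjugator on the support of
      \<open>?x\<close>, where \<open>d\<close> and \<open>h\<close> agree.\<close>
    have "h \<circ> ?x \<circ> inv h = d \<circ> ?x \<circ> inv d"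
    proof (rule ext)
      fix p
      show "(h \<circ> ?x \<circ> inv h) p = (d \<circ> ?x \<circ> inv d) p"
      proof (cases "inv h p \<in> cyl w")
        case True
        then have "d (inv h p) = p" using d(2) h by simp
        then have "inv d p = inv h p" using dV by (metis VG_inv_left)
        then show ?thesis using supported_image[OF xV xs True] d(2) by simp
      next
        case False
        have "inv d p \<notin> cyl w"
        proof
          assume "inv d p \<in> cyl w"
          then have "h (inv d p) = p" using d(2) dV by (metis VG_inv_right)
          then show False using False h \<open>inv d p \<in> cyl w\<close> by (metis VG_inv_left)
        qed
        then show ?thesis using False xs h dV by (simp add: supported_def)
      qed
    qed
    then show "h \<circ> ?x \<circ> inv h \<in> N" using N_conj[OF d(1) w(2)[OF fg]] by simp
  qed (use fg in simp)
  obtain k where k: "k \<in> VG G" "\<And>p. p \<notin> cyl z \<Longrightarrow> k p \<in> cyl w"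
    using complement_into_cyl[OF z(1) w(1)] by blast
  have "supported f (- cyl z)" "supported g (- cyl z)" using z by (auto simp: supported_def)
  then have "supported (k \<circ> f \<circ> inv k) (cyl w)" "supported (k \<circ> g \<circ> inv k) (cyl w)"
    using fg k by (auto intro!: supported_conj[where A = "- cyl z"])
  then have "comm (k \<circ> f \<circ> inv k) (k \<circ> g \<circ> inv k) \<in> M"
    using local fg k by simp
  then have "inv k \<circ> comm (k \<circ> f \<circ> inv k) (k \<circ> g \<circ> inv k) \<circ> inv (inv k) \<in> M"
    by (rule M_conj) (simp add: k)
  moreover have "inv k \<circ> comm (k \<circ> f \<circ> inv k) (k \<circ> g \<circ> inv k) \<circ> inv (inv k) = comm f g"
    using fg k by (auto simp: comm_def)
  ultimately show ?thesis by simp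
qed

text \<open>Cylinders that meet are nested, and the inner one is fixed by both elements. If they are
  disjoint, \<open>f\<close> is first replaced, modulo \<open>M\<close>, by a conjugate fixing
  \<open>cyl y\<close>.\<close>

lemma comm_small_in_M:
  assumes "small f" "small g"
  shows "comm f g \<in> M"
proof -
  obtain z y where fg: "f \<in> VG G" "g \<in> VG G" and z: "z \<noteq> []" "\<And>p. p \<in> cyl z \<Longrightarrow> f p = p"
    and y: "y \<noteq> []" "\<And>p. p \<in> cyl y \<Longrightarrow> g p = p"
    using assms unfolding small_def by blast
  show ?thesis
  proof (cases "cyl z \<inter> cyl y = {}")
    case False
    then consider t where "y = z @ t" | t where "z = y @ t"
      using cyl_Int_imp_prefix[of z y] cyl_Int_imp_prefix[of y z] by (cases "length z \<le> length y") (auto simp: Int_commute)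
    then show ?thesis
    proof cases
      case 1
      then show ?thesis using fg z y cyl_append_subset by (intro comm_common_fix_in_M[of f g y]) blast+
    next
      case 2
      then show ?thesis using fg z y cyl_append_subset by (intro comm_common_fix_in_M[of f g z]) blast+
    qed
  next
    case True
    obtain a b :: 'x where ab: "a \<noteq> b" by (rule two_letters)
    \<comment> \<open>Only a part of \<open>cyl z\<close> is exchanged with \<open>cyl y\<close>, so
      that \<open>cyl (z @ [a])\<close> stays fixed by \<open>f\<close> and \<open>?k\<close>
      together.\<close>
    let ?k = "swp (z @ [b]) y id"
    have disj: "cyl (z @ [b]) \<inter> cyl y = {}" "cyl (z @ [a]) \<inter> cyl (z @ [b]) = {}" "cyl (z @ [a]) \<inter> cyl y = {}"
      using True cyl_append_subset ab by (blast, auto intro!: cyl_append_disjoint simp: cyl_Cons_iff dest: cyl_append_subset)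
    have k: "?k \<in> VG G" by (rule swp_VG[OF disj(1)]) simp
    have m: "comm f ?k \<in> M"
    proof (rule comm_common_fix_in_M[OF fg(1) k, of "z @ [a]"])
      show "f p = p" if "p \<in> cyl (z @ [a])" for p using that z cyl_append_subset by blast
      show "?k p = p" if "p \<in> cyl (z @ [a])" for p using that disj by (intro swp_other) auto
    qed simp
    let ?f = "?k \<circ> f \<circ> inv ?k"
    have fV: "?f \<in> VG G" using fg k by simp
    have "?f p = p" if "p \<in> cyl y" for p
    proof -
      have "inv ?k p \<in> cyl (z @ [b])"
        using that k swp_cyl_iff[OF disj(1) id_in_G, of "inv ?k p"] by simp
      then have "f (inv ?k p) = inv ?k p" using z(2) cyl_append_subset by blast
      then show ?thesis using k by simp
    qed
    then have c: "comm ?f g \<in> M"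
      using fV fg y by (intro comm_common_fix_in_M[of ?f g y])
    let ?m = "comm f ?k"
    \<comment> \<open>Obtained by expanding the commutator with
      \<open>f = ?m \<circ> ?f\<close>.\<close>
    have "comm f g = ?m \<circ> comm ?f g \<circ> (g \<circ> inv ?m \<circ> inv g)"
      using fg k by (auto simp: comm_def)
    then show ?thesis using m c M_comp M_conj M_inv fg by simp
  qed
qed

text \<open>Commutators are multiplicative up to conjugation in the first argument, and swapping the
  arguments inverts them. Factoring both elements into small ones therefore reduces the claim to
  \<open>comm_small_in_M\<close>.\<close>

lemma comm_in_M:
  assumes "f \<in> VG G" "g \<in> VG G"
  shows "comm f g \<in> M"
proof -
  have comp: "comm (x \<circ> y) g \<in> M" if "comm x g \<in> M" "comm y g \<in> M" "x \<in> VG G" "y \<in> VG G" "g \<in> VG G" for x y g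
  proof -
    have "comm (x \<circ> y) g = (x \<circ> comm y g \<circ> inv x) \<circ> comm x g"
      using that by (auto simp: comm_def)
    then show ?thesis using that M_comp M_conj by simp
  qed
  have sym: "comm x y \<in> M" if "comm y x \<in> M" "x \<in> VG G" "y \<in> VG G" for x y
  proof -
    have "comm x y = inv (comm y x)" using that by (simp add: comm_def comp_assoc)
    then show ?thesis using that M_inv by simp
  qed
  obtain s t where st: "small s" "small t" "f = s \<circ> t"
    by (rule VG_product_of_small[OF assms(1)])
  obtain q r where qr: "small q" "small r" "g = q \<circ> r"
    by (rule VG_product_of_small[OF assms(2)])
  have "comm g x \<in> M" if "small x" for x
    unfolding qr(3) using comp comm_small_in_M qr that small_VG by simp
  then show ?thesis
    unfolding st(3) using comp sym st small_VG assms by simp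
qed

lemma N_eq_D: "N = D"
proof
  show "N \<subseteq> D" using N_D by blast
  show "D \<subseteq> N" using D_least[OF subgroup_N] comm_in_M M_N by blast
qed

end

theorem theorem4p6:
  fixes G :: "('x::finite list \<Rightarrow> 'x list) set"
  assumes "CARD('x) \<ge> 2"
    and "self_similar G"
  shows "simple_grp ((VG_group G)\<lparr>carrier := derived (VG_group G) (carrier (VG_group G))\<rparr>)"
proof -
  interpret self_similar_group G
    using assms by unfold_locales
  have "group ((VG_group G)\<lparr>carrier := D\<rparr>)"
    by (rule subgroup.subgroup_is_group[OF subgroup_D group_VG])
  moreover have "D \<noteq> {id}" using D_nontrivial by auto
  moreover have "N = D" if "normal N ((VG_group G)\<lparr>carrier := D\<rparr>)" "N \<noteq> {id}" for N
  proof -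
    interpret normal_in_derived G N
      by (intro normal_in_derived.intro normal_in_derived_axioms.intro self_similar_group_axioms that)
    show ?thesis by (rule N_eq_D)
  qed
  ultimately have "simple_grp ((VG_group G)\<lparr>carrier := D\<rparr>)"
    unfolding simple_grp_def by (auto simp: VG_group_def)
  then show ?thesis unfolding D_def .
qed

end
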